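(* Let $(R,\mathfrak{m})$ be an $F$-injective Cohen--Macaulay local ring of prime characteristic $p$ and dimension $d>0$, let $a_1,\dots,a_d$ be a system of parameters, $\mathfrak{q}:=(a_1,\dots,a_d)R$, and $H:=H^d_{\mathfrak{m}}(R)$. For $b\in R$ let $\mathfrak{q}(b):=\{c\in R: cb^{p^n}\in\mathfrak{q}^{[p^n]}\text{ for all } n\gg0\}$, and let $Z_{\mathfrak{q},R}:=\{\mathfrak{q}(b): b\in R\setminus\mathfrak{q}\}$. Then the set of maximal members (under inclusion) of $Z_{\mathfrak{q},R}$ equals the set of maximal members of $\mathcal{I}(H)\setminus\{R\}$.
   Context: $R[x,f]$ is the Frobenius skew polynomial ring (free left $R$-module on $x^i$, $i\ge0$, with $xr=r^px$). $H^d_{\mathfrak{m}}(R)$ has its natural left $R[x,f]$-module structure: via the Čech complex on $a_1,\dots,a_d$, $x[r/(a_1\cdots a_d)^j]=[r^p/(a_1\cdots a_d)^{jp}]$. The graded annihilator $\operatorname{grann}N$ of an $R[x,f]$-submodule $N$ is the set of $\sum r_ix^i$ with each $r_ix^i$ annihilating $N$. $\mathcal{I}(H)$ is the set of ideals $\mathfrak{b}$ of $R$ for which there is an $R[x,f]$-submodule $N$ of $H$ with $\operatorname{grann}N=\bigoplus_{n\ge0}\mathfrak{b}x^n$. $\mathfrak{q}^{[p^n]}$ is the ideal generated by $p^n$-th powers of elements of $\mathfrak{q}$. $F$-injective: the Frobenius-induced maps on all $H^i_\mathfrak{m}(R)$ are injective. *)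

theory Defs
  imports "HOL-Computational_Algebra.Primes"
begin

definition ideal_gen :: "'a::comm_ring_1 set \<Rightarrow> 'a set" where
  "ideal_gen S = {x. \<exists>F f. finite F \<and> F \<subseteq> S \<and> x = (\<Sum>s\<in>F. f s * s)}"

definition is_ideal :: "'a::comm_ring_1 set \<Rightarrow> bool" where
  "is_ideal I \<longleftrightarrow> 0 \<in> I \<and> (\<forall>x\<in>I. \<forall>y\<in>I. x + y \<in> I) \<and> (\<forall>r. \<forall>x\<in>I. r * x \<in> I)"

definition is_max_ideal :: "'a::comm_ring_1 set \<Rightarrow> bool" where
  "is_max_ideal M \<longleftrightarrow> is_ideal M \<and> M \<noteq> UNIV \<and>
     (\<forall>J. is_ideal J \<and> M \<subseteq> J \<longrightarrow> J = M \<or> J = UNIV)"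

definition is_prime_ideal :: "'a::comm_ring_1 set \<Rightarrow> bool" where
  "is_prime_ideal P \<longleftrightarrow> is_ideal P \<and> P \<noteq> UNIV \<and> (\<forall>x y. x * y \<in> P \<longrightarrow> x \<in> P \<or> y \<in> P)"

definition noetherian_local_ring :: "'a::comm_ring_1 set \<Rightarrow> bool" where
  "noetherian_local_ring m \<longleftrightarrow>
     (\<forall>I :: 'a set. is_ideal I \<longrightarrow> (\<exists>F. finite F \<and> I = ideal_gen F)) \<and>
     is_max_ideal m \<and> (\<forall>J. is_max_ideal J \<longrightarrow> J = m)"

definition prime_chain :: "(nat \<Rightarrow> 'a::comm_ring_1 set) \<Rightarrow> nat \<Rightarrow> bool" where
  "prime_chain P n \<longleftrightarrow> (\<forall>i\<le>n. is_prime_ideal (P i)) \<and> (\<forall>i<n. P i \<subset> P (Suc i))"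

definition krull_dim_eq :: "'a::comm_ring_1 itself \<Rightarrow> nat \<Rightarrow> bool" where
  "krull_dim_eq _ d \<longleftrightarrow> (\<exists>P::nat \<Rightarrow> 'a set. prime_chain P d) \<and>
                        \<not> (\<exists>P::nat \<Rightarrow> 'a set. prime_chain P (Suc d))"

definition regular_seq_in :: "'a::comm_ring_1 set \<Rightarrow> (nat \<Rightarrow> 'a) \<Rightarrow> nat \<Rightarrow> bool" where
  "regular_seq_in m x n \<longleftrightarrow> (\<forall>i<n. x i \<in> m \<and>
      (\<forall>y. x i * y \<in> ideal_gen (x ` {..<i}) \<longrightarrow> y \<in> ideal_gen (x ` {..<i})))"

definition depth_eq :: "'a::comm_ring_1 set \<Rightarrow> nat \<Rightarrow> bool" where
  "depth_eq m k \<longleftrightarrow> (\<exists>x. regular_seq_in m x k) \<and> \<not> (\<exists>x. regular_seq_in m x (Suc k))"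

definition cohen_macaulay :: "'a::comm_ring_1 set \<Rightarrow> nat \<Rightarrow> bool" where
  "cohen_macaulay m d \<longleftrightarrow> krull_dim_eq TYPE('a) d \<and> depth_eq m d"

definition system_of_parameters :: "'a::comm_ring_1 set \<Rightarrow> (nat \<Rightarrow> 'a) \<Rightarrow> nat \<Rightarrow> bool" where
  "system_of_parameters m a d \<longleftrightarrow> krull_dim_eq TYPE('a) d \<and> (\<forall>i<d. a i \<in> m) \<and>
     (\<forall>x\<in>m. \<exists>e. x ^ e \<in> ideal_gen (a ` {..<d}))"

definition prodS :: "(nat \<Rightarrow> 'a::comm_ring_1) \<Rightarrow> nat set \<Rightarrow> 'a" where
  "prodS c S = (\<Prod>i\<in>S. c i)"

definition sgn_in :: "nat \<Rightarrow> nat set \<Rightarrow> 'a::comm_ring_1" where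
  "sgn_in j T = (-1) ^ card {l\<in>T. l < j}"

text \<open>A degree-i Cech cochain is given by (z, n): its component at S (card S = i,
  S \<subseteq> {..<k}) is z S / (prod_{s in S} c_s)^n in the localization R_{c_S}.
  The map R_{c_(T-j)} \<rightarrow> R_{c_T} sends y/c_(T-j)^n to y c_j^n / c_T^n.\<close>
definition cech_cocycle :: "(nat \<Rightarrow> 'a::comm_ring_1) \<Rightarrow> nat \<Rightarrow> nat \<Rightarrow> (nat set \<Rightarrow> 'a) \<Rightarrow> nat \<Rightarrow> bool" where
  "cech_cocycle c k i z n \<longleftrightarrow>
     (\<forall>T. T \<subseteq> {..<k} \<and> card T = Suc i \<longrightarrow>
        (\<exists>t. prodS c T ^ t * (\<Sum>j\<in>T. sgn_in j T * z (T - {j}) * c j ^ n) = 0))"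

definition cech_coboundary :: "(nat \<Rightarrow> 'a::comm_ring_1) \<Rightarrow> nat \<Rightarrow> nat \<Rightarrow> (nat set \<Rightarrow> 'a) \<Rightarrow> nat \<Rightarrow> bool" where
  "cech_coboundary c k i z n \<longleftrightarrow>
     (\<exists>(y :: nat set \<Rightarrow> 'a) m. \<forall>S. S \<subseteq> {..<k} \<and> card S = i \<longrightarrow>
        (\<exists>t. prodS c S ^ t *
              (z S * prodS c S ^ m - (\<Sum>j\<in>S. sgn_in j S * y (S - {j}) * c j ^ m) * prodS c S ^ n) = 0))"

definition frobenius_injective_cech :: "nat \<Rightarrow> (nat \<Rightarrow> 'a::comm_ring_1) \<Rightarrow> nat \<Rightarrow> bool" where
  "frobenius_injective_cech p c k \<longleftrightarrow>
     (\<forall>i z n. cech_cocycle c k i z n \<and> cech_coboundary c k i (\<lambda>S. z S ^ p) (n * p)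
              \<longrightarrow> cech_coboundary c k i z n)"

text \<open>F-injective: Frobenius injective on all H^i_m(R), computed by the Cech complex on
  any finite sequence in m generating an m-primary ideal.\<close>
definition F_injective :: "nat \<Rightarrow> 'a::comm_ring_1 set \<Rightarrow> bool" where
  "F_injective p m \<longleftrightarrow>
     (\<forall>k (c :: nat \<Rightarrow> 'a). (\<forall>i<k. c i \<in> m) \<and> (\<forall>x\<in>m. \<exists>e. x ^ e \<in> ideal_gen (c ` {..<k}))
        \<longrightarrow> frobenius_injective_cech p c k)"

section \<open>H = H^d_m(R) as top Cech cohomology on a_0..a_(d-1), with Frobenius action\<close>

text \<open>(r, n) represents [r / (a_1 ... a_d)^n]; it is zero iff it is a Cech coboundary.\<close>
definition H_zero :: "(nat \<Rightarrow> 'a::comm_ring_1) \<Rightarrow> nat \<Rightarrow> 'a \<Rightarrow> nat \<Rightarrow> bool" where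
  "H_zero a d r n \<longleftrightarrow> cech_coboundary a d d (\<lambda>S. r) n"

definition H_eq :: "(nat \<Rightarrow> 'a::comm_ring_1) \<Rightarrow> nat \<Rightarrow> 'a \<times> nat \<Rightarrow> 'a \<times> nat \<Rightarrow> bool" where
  "H_eq a d x y \<longleftrightarrow> (case x of (r, n) \<Rightarrow> case y of (s, m) \<Rightarrow>
      H_zero a d (r * prodS a {..<d} ^ m - s * prodS a {..<d} ^ n) (n + m))"

text \<open>An R[x,f]-submodule of H, given as the (saturated) set of its representatives.\<close>
definition H_Rxf_submodule :: "nat \<Rightarrow> (nat \<Rightarrow> 'a::comm_ring_1) \<Rightarrow> nat \<Rightarrow> ('a \<times> nat) set \<Rightarrow> bool" where
  "H_Rxf_submodule p a d N \<longleftrightarrow>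
     (0, 0) \<in> N \<and>
     (\<forall>x y. x \<in> N \<and> H_eq a d x y \<longrightarrow> y \<in> N) \<and>
     (\<forall>r n s m. (r, n) \<in> N \<and> (s, m) \<in> N \<longrightarrow>
         (r * prodS a {..<d} ^ m + s * prodS a {..<d} ^ n, n + m) \<in> N) \<and>
     (\<forall>c r n. (r, n) \<in> N \<longrightarrow> (c * r, n) \<in> N) \<and>
     (\<forall>r n. (r, n) \<in> N \<longrightarrow> (r ^ p, n * p) \<in> N)"

text \<open>Degree-e part of grann N: {c. c x^e N = 0}, with x^e [s/A^m] = [s^(p^e)/A^(m p^e)].\<close>
definition grann_deg :: "nat \<Rightarrow> (nat \<Rightarrow> 'a::comm_ring_1) \<Rightarrow> nat \<Rightarrow> ('a \<times> nat) set \<Rightarrow> nat \<Rightarrow> 'a set" where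
  "grann_deg p a d N e = {c. \<forall>s m. (s, m) \<in> N \<longrightarrow> H_zero a d (c * s ^ (p ^ e)) (m * p ^ e)}"

text \<open>I(H): ideals b with grann N = (+)_{n\<ge>0} b x^n for some R[x,f]-submodule N.\<close>
definition I_H :: "nat \<Rightarrow> (nat \<Rightarrow> 'a::comm_ring_1) \<Rightarrow> nat \<Rightarrow> 'a set set" where
  "I_H p a d = {b. is_ideal b \<and> (\<exists>N. H_Rxf_submodule p a d N \<and> (\<forall>e. grann_deg p a d N e = b))}"

definition frob_power :: "'a::comm_ring_1 set \<Rightarrow> nat \<Rightarrow> nat \<Rightarrow> 'a set" where
  "frob_power I p n = ideal_gen {x ^ (p ^ n) | x. x \<in> I}"

definition q_of :: "nat \<Rightarrow> 'a::comm_ring_1 set \<Rightarrow> 'a \<Rightarrow> 'a set" where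
  "q_of p q b = {c. \<exists>n0. \<forall>n\<ge>n0. c * b ^ (p ^ n) \<in> frob_power q p n}"

definition Z_set :: "nat \<Rightarrow> 'a::comm_ring_1 set \<Rightarrow> 'a set set" where
  "Z_set p q = {q_of p q b | b. b \<notin> q}"

definition maximal_members :: "'b set set \<Rightarrow> 'b set set" where
  "maximal_members S = {X \<in> S. \<forall>Y\<in>S. X \<subseteq> Y \<longrightarrow> Y = X}"

end

theory Submission
  imports Defs
begin

text \<open>
  The ideal \<open>q(b)\<close> is the graded annihilator of \<open>R[x,f] h\<close> for \<open>h = [b / (a\<^sub>1 \<cdots> a\<^sub>d)]\<close>, because Frobenius
  is injective on \<open>H\<close>; and \<open>h \<noteq> 0\<close> if and only if \<open>b \<notin> q\<close>. Conversely, a nonzero submodule \<open>N\<close> of \<open>H\<close>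
  contains a nonzero element killed by \<open>q\<close>, such an element has the form \<open>[b / (a\<^sub>1 \<cdots> a\<^sub>d)]\<close> with
  \<open>b \<notin> q\<close>, and the annihilator of \<open>N\<close> is contained in \<open>q(b)\<close>. Hence the \<open>q(b)\<close> are proper members
  of \<open>I(H)\<close> and every proper member lies below one of them, so the maximal members agree.

  The Cohen--Macaulay property enters only through the fact that each \<open>a\<^sub>j\<close> is a nonzerodivisor modulo
  arbitrary powers of the other parameters. This needs no dimension theory: if \<open>y\<^sub>1, \<dots>, y\<^sub>d\<close> is a
  regular sequence in the radical of \<open>(x\<^sub>1, \<dots>, x\<^sub>d)\<close>, then the Koszul cohomology of \<open>x\<close> vanishes
  below degree \<open>d\<close>.
\<close>

section \<open>Ideals spanned by families\<close>

text \<open>Coefficients are indexed by positions rather than by elements, so equal generators stay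
  apart and the term at one index can be split off a sum.\<close>

definition lin_span :: "('i \<Rightarrow> 'a::comm_ring_1) \<Rightarrow> 'i set \<Rightarrow> 'a set" where
  "lin_span x A = {\<Sum>i\<in>A. c i * x i | c. True}"

lemma lin_spanI: "u = (\<Sum>i\<in>A. c i * x i) \<Longrightarrow> u \<in> lin_span x A"
  by (auto simp: lin_span_def)

lemma lin_spanE:
  assumes "u \<in> lin_span x A"
  obtains c where "u = (\<Sum>i\<in>A. c i * x i)"
  using assms by (auto simp: lin_span_def)

lemma lin_span_iff: "u \<in> lin_span x A \<longleftrightarrow> (\<exists>c. u = (\<Sum>i\<in>A. c i * x i))"
  by (auto simp: lin_span_def)

lemma lin_span_cong: "(\<And>i. i \<in> A \<Longrightarrow> x i = y i) \<Longrightarrow> lin_span x A = lin_span y A"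
  unfolding lin_span_def by (simp cong: sum.cong)

lemma is_ideal_lin_span: "is_ideal (lin_span x A)"
  unfolding is_ideal_def
proof (intro conjI ballI allI)
  show "0 \<in> lin_span x A" by (rule lin_spanI[where c = "\<lambda>_. 0"]) simp
next
  fix u v assume "u \<in> lin_span x A" "v \<in> lin_span x A"
  then obtain c e where "u = (\<Sum>i\<in>A. c i * x i)" "v = (\<Sum>i\<in>A. e i * x i)"
    unfolding lin_span_iff by blast
  then show "u + v \<in> lin_span x A"
    by (intro lin_spanI[where c = "\<lambda>i. c i + e i"]) (simp add: sum.distrib distrib_right)
next
  fix r u assume "u \<in> lin_span x A"
  then obtain c where "u = (\<Sum>i\<in>A. c i * x i)" by (rule lin_spanE)
  then show "r * u \<in> lin_span x A"
    by (intro lin_spanI[where c = "\<lambda>i. r * c i"]) (simp add: sum_distrib_left mult.assoc)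
qed

lemma is_ideal_0: "is_ideal I \<Longrightarrow> 0 \<in> I"
  by (simp add: is_ideal_def)

lemma is_ideal_add: "is_ideal I \<Longrightarrow> u \<in> I \<Longrightarrow> v \<in> I \<Longrightarrow> u + v \<in> I"
  by (simp add: is_ideal_def)

lemma is_ideal_mult: "is_ideal I \<Longrightarrow> u \<in> I \<Longrightarrow> r * u \<in> I"
  by (simp add: is_ideal_def)

lemma is_ideal_diff: "is_ideal I \<Longrightarrow> u \<in> I \<Longrightarrow> v \<in> I \<Longrightarrow> u - v \<in> I"
  using is_ideal_add[of I u "- v"] is_ideal_mult[of I v "- 1"] by simp

lemma is_ideal_sum: "is_ideal I \<Longrightarrow> (\<And>i. i \<in> A \<Longrightarrow> f i \<in> I) \<Longrightarrow> sum f A \<in> I"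
  by (induction A rule: infinite_finite_induct) (auto simp: is_ideal_0 intro: is_ideal_add)

lemmas lin_span_0 = is_ideal_0[OF is_ideal_lin_span]
lemmas lin_span_add = is_ideal_add[OF is_ideal_lin_span]
lemmas lin_span_mult = is_ideal_mult[OF is_ideal_lin_span]

lemma lin_span_generator:
  assumes "finite A" "i \<in> A"
  shows "x i \<in> lin_span x A"
proof (rule lin_spanI)
  show "x i = (\<Sum>k\<in>A. (if k = i then 1 else 0) * x k)"
    using assms by (simp add: if_distrib[of "\<lambda>c. c * _"] cong: if_cong)
qed

lemma lin_span_least:
  assumes "is_ideal I" "\<And>i. i \<in> A \<Longrightarrow> x i \<in> I"
  shows "lin_span x A \<subseteq> I"
  using assms by (auto elim!: lin_spanE intro!: is_ideal_sum is_ideal_mult)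

lemma is_ideal_ideal_gen: "is_ideal (ideal_gen S)"
  unfolding is_ideal_def
proof (intro conjI ballI allI)
  show "0 \<in> ideal_gen S" by (auto simp: ideal_gen_def intro!: exI[of _ "{}"])
next
  fix u v assume "u \<in> ideal_gen S" "v \<in> ideal_gen S"
  then obtain F f G g where *: "finite F" "F \<subseteq> S" "u = (\<Sum>s\<in>F. f s * s)"
    "finite G" "G \<subseteq> S" "v = (\<Sum>s\<in>G. g s * s)" by (auto simp: ideal_gen_def)
  have "u = (\<Sum>s\<in>F \<union> G. (if s \<in> F then f s else 0) * s)"
    unfolding * using * by (intro sum.mono_neutral_cong_left) auto
  moreover have "v = (\<Sum>s\<in>F \<union> G. (if s \<in> G then g s else 0) * s)"
    unfolding * using * by (intro sum.mono_neutral_cong_left) auto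
  ultimately have "u + v = (\<Sum>s\<in>F \<union> G. ((if s \<in> F then f s else 0) + (if s \<in> G then g s else 0)) * s)"
    by (simp only: sum.distrib distrib_right)
  then show "u + v \<in> ideal_gen S"
    unfolding ideal_gen_def using * by (intro CollectI exI[of _ "F \<union> G"]) auto
next
  fix r u assume "u \<in> ideal_gen S"
  then obtain F f where *: "finite F" "F \<subseteq> S" "u = (\<Sum>s\<in>F. f s * s)"
    by (auto simp: ideal_gen_def)
  then have "r * u = (\<Sum>s\<in>F. (r * f s) * s)" by (simp add: sum_distrib_left mult.assoc)
  with * show "r * u \<in> ideal_gen S"
    unfolding ideal_gen_def by (intro CollectI exI[of _ F] exI[of _ "\<lambda>s. r * f s"]) auto
qed

lemma ideal_gen_superset: "S \<subseteq> ideal_gen S"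
  unfolding ideal_gen_def by (auto intro!: exI[of _ "{_}"] exI[of _ "\<lambda>_. 1"])

lemma ideal_gen_least: "is_ideal I \<Longrightarrow> S \<subseteq> I \<Longrightarrow> ideal_gen S \<subseteq> I"
  by (auto simp: ideal_gen_def intro!: is_ideal_sum is_ideal_mult)

lemma ideal_gen_image: "finite A \<Longrightarrow> ideal_gen (x ` A) = lin_span x A"
  using ideal_gen_superset[of "x ` A"]
  by (intro equalityI ideal_gen_least lin_span_least is_ideal_ideal_gen is_ideal_lin_span)
    (auto intro: lin_span_generator)

section \<open>Koszul cochains\<close>

text \<open>A cochain of degree \<open>i\<close> is encoded as a function on all sets, of which only
  the values at sets of size \<open>i\<close> count.\<close>

definition koszul_d :: "(nat \<Rightarrow> 'a::comm_ring_1) \<Rightarrow> (nat set \<Rightarrow> 'a) \<Rightarrow> nat set \<Rightarrow> 'a" where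
  "koszul_d x z T = (\<Sum>j\<in>T. sgn_in j T * x j * z (T - {j}))"

lemma sgn_in_square [simp]: "sgn_in j T * sgn_in j T = (1 :: 'a::comm_ring_1)"
  by (simp add: sgn_in_def flip: power_mult_distrib)

lemma sgn_in_square_left [simp]: "sgn_in j T * (sgn_in j T * u) = (u :: 'a::comm_ring_1)"
  by (simp flip: mult.assoc)

lemma sgn_in_remove:
  assumes "finite T" "l \<in> T"
  shows "(sgn_in j (T - {l}) :: 'a::comm_ring_1) = (if l < j then - sgn_in j T else sgn_in j T)"
proof (cases "l < j")
  case True
  have "{i \<in> T. i < j} = insert l {i \<in> T - {l}. i < j}" using True assms by auto
  then have "card {i \<in> T. i < j} = Suc (card {i \<in> T - {l}. i < j})" using assms by simp
  then show ?thesis using True by (simp add: sgn_in_def)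
next
  case False
  then have "{i \<in> T - {l}. i < j} = {i \<in> T. i < j}" by auto
  then show ?thesis using False by (simp add: sgn_in_def)
qed

lemma sgn_in_insert_same [simp]: "sgn_in j (insert j T) = sgn_in j T"
proof -
  have "{l \<in> insert j T. l < j} = {l \<in> T. l < j}" by auto
  then show ?thesis by (simp add: sgn_in_def)
qed

lemma sgn_in_empty [simp]: "sgn_in j {} = 1"
  by (simp add: sgn_in_def)

lemma koszul_d_add: "koszul_d x (\<lambda>S. z S + w S) T = koszul_d x z T + koszul_d x w T"
  by (simp add: koszul_d_def sum.distrib algebra_simps)

lemma koszul_d_mult: "koszul_d x (\<lambda>S. r * z S) T = r * koszul_d x z T"
  by (simp add: koszul_d_def sum_distrib_left algebra_simps)

lemma koszul_d_sum:
  "koszul_d x (\<lambda>S. \<Sum>i\<in>A. z i S) T = (\<Sum>i\<in>A. koszul_d x (z i) T)"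
  unfolding koszul_d_def by (subst sum.swap) (simp add: sum_distrib_left)

lemma koszul_d_mem:
  assumes "is_ideal I" "\<And>j. j \<in> T \<Longrightarrow> z (T - {j}) \<in> I"
  shows "koszul_d x z T \<in> I"
  unfolding koszul_d_def using assms by (intro is_ideal_sum is_ideal_mult)

lemma koszul_d_d:
  assumes "finite T"
  shows "koszul_d x (koszul_d x z) T = (0::'a::comm_ring_1)"
proof -
  define g where "g j l = sgn_in j T * x j * (sgn_in l (T - {j}) * x l * z (T - {j} - {l}))" for j l
  \<comment> \<open>Deleting the smaller index changes the sign of the larger one and not
    conversely, so the two orders of deletion cancel.\<close>
  have anti: "g j l = - g l j" if "j \<in> T" "l \<in> T" "l < j" for j l
    using that assms
    by (simp add: g_def sgn_in_remove Diff_insert2[symmetric] insert_commute ac_simps)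
  have "koszul_d x (koszul_d x z) T = (\<Sum>j\<in>T. \<Sum>l\<in>T - {j}. g j l)"
    by (simp add: koszul_d_def g_def sum_distrib_left)
  also have "\<dots> = (\<Sum>j\<in>T. (\<Sum>l\<in>{l\<in>T. l < j}. g j l) + (\<Sum>l\<in>{l\<in>T. j < l}. g j l))"
  proof (rule sum.cong[OF refl])
    fix j
    have "T - {j} = {l\<in>T. l < j} \<union> {l\<in>T. j < l}" by auto
    moreover have "sum (g j) ({l\<in>T. l < j} \<union> {l\<in>T. j < l}) = sum (g j) {l\<in>T. l < j} + sum (g j) {l\<in>T. j < l}"
      using assms by (intro sum.union_disjoint) auto
    ultimately show "sum (g j) (T - {j}) = sum (g j) {l\<in>T. l < j} + sum (g j) {l\<in>T. j < l}"
      by metis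
  qed
  also have "\<dots> = (\<Sum>j\<in>T. \<Sum>l\<in>{l\<in>T. l < j}. g j l) + (\<Sum>l\<in>T. \<Sum>j\<in>{j\<in>T. j < l}. g j l)"
    using sum.swap_restrict[OF assms assms, of g "\<lambda>j l. j < l"] by (simp add: sum.distrib)
  also have "(\<Sum>j\<in>T. \<Sum>l\<in>{l\<in>T. l < j}. g j l) = (\<Sum>j\<in>T. \<Sum>l\<in>{l\<in>T. l < j}. - g l j)"
    using anti by (intro sum.cong refl) auto
  finally show ?thesis by (simp add: sum_negf)
qed

definition koszul_s :: "nat \<Rightarrow> (nat set \<Rightarrow> 'a::comm_ring_1) \<Rightarrow> nat set \<Rightarrow> 'a" where
  "koszul_s j z S = (if j \<in> S then 0 else sgn_in j S * z (insert j S))"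

text \<open>Contraction with the \<open>j\<close>-th basis vector is a homotopy from multiplication
  by \<open>x j\<close> to zero; this is why every \<open>x j\<close> kills the Koszul
  cohomology.\<close>

lemma koszul_homotopy:
  assumes "finite S"
  shows "koszul_d x (koszul_s j z) S + koszul_s j (koszul_d x z) S = x j * z S"
proof (cases "j \<in> S")
  case True
  have "koszul_d x (koszul_s j z) S = (\<Sum>l\<in>S. if l = j then x j * z S else 0)"
    unfolding koszul_d_def
    using True assms by (intro sum.cong refl) (auto simp: koszul_s_def sgn_in_remove insert_absorb ac_simps)
  then show ?thesis using True assms by (simp add: koszul_s_def)
next
  case False
  have "koszul_s j (koszul_d x z) S = x j * z S +
      (\<Sum>l\<in>S. sgn_in j S * (sgn_in l (insert j S) * x l * z (insert j S - {l})))"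
    using False assms
    by (simp add: koszul_s_def koszul_d_def sum_distrib_left distrib_left mult.assoc)
  also have "(\<Sum>l\<in>S. sgn_in j S * (sgn_in l (insert j S) * x l * z (insert j S - {l})))
     = - koszul_d x (koszul_s j z) S"
    unfolding koszul_d_def sum_negf[symmetric]
  proof (rule sum.cong[OF refl])
    fix l assume l: "l \<in> S"
    then have *: "insert j S - {l} = insert j (S - {l})" using False by auto
    have "sgn_in l S = (if j < l then - sgn_in l (insert j S) else sgn_in l (insert j S) :: 'a)"
      using sgn_in_remove[of "insert j S" j l] assms False by simp
    then show "sgn_in j S * (sgn_in l (insert j S) * x l * z (insert j S - {l}))
      = - (sgn_in l S * x l * koszul_s j z (S - {l}))"
      using l False assms unfolding *
      by (cases "j < l") (auto simp: koszul_s_def sgn_in_remove ac_simps)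
  qed
  finally show ?thesis by simp
qed

text \<open>Modulo \<open>(y\<^sub>0, \<dots>, y\<^sub>n\<^sub>-\<^sub>1)\<close>, a power of \<open>y\<^sub>n\<close> kills the cohomology in degree \<open>i\<close>, since every
  \<open>x\<^sub>j\<close> does, while \<open>y\<^sub>n\<close> acts injectively on it as soon as the cohomology modulo
  \<open>(y\<^sub>0, \<dots>, y\<^sub>n)\<close> vanishes in degree \<open>i - 1\<close>.\<close>

lemma koszul_exact:
  fixes x y :: "nat \<Rightarrow> 'a::comm_ring_1"
  assumes reg: "\<And>i u. i < e \<Longrightarrow> y i * u \<in> lin_span y {..<i} \<Longrightarrow> u \<in> lin_span y {..<i}"
    and rad: "\<And>i. i < e \<Longrightarrow> \<exists>N. y i ^ N \<in> lin_span x {..<k}"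
    and "n + i < e"
    and "\<And>T. T \<subseteq> {..<k} \<Longrightarrow> card T = Suc i \<Longrightarrow> koszul_d x z T \<in> lin_span y {..<n}"
  shows "\<exists>w. \<forall>S. S \<subseteq> {..<k} \<and> card S = i \<longrightarrow> z S - koszul_d x w S \<in> lin_span y {..<n}"
  using assms(3,4)
proof (induction i arbitrary: n z)
  case (0 n z)
  \<comment> \<open>Degree 0 has no coboundaries, and the cocycle condition at singletons says that
    every \<open>x j\<close> carries \<open>z {}\<close> into the ideal.\<close>
  then have z: "x j * z {} \<in> lin_span y {..<n}" if "j < k" for j
    using that 0(2)[of "{j}"] by (simp add: koszul_d_def)
  obtain N where "y n ^ N \<in> lin_span x {..<k}" using rad 0 by auto
  then obtain c where "y n ^ N = (\<Sum>j<k. c j * x j)" by (rule lin_spanE)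
  then have "y n ^ N * z {} = (\<Sum>j<k. c j * (x j * z {}))"
    by (simp add: sum_distrib_right mult.assoc)
  also have "\<dots> \<in> lin_span y {..<n}"
    by (rule is_ideal_sum[OF is_ideal_lin_span], rule lin_span_mult, rule z) simp
  finally have "y n ^ N * z {} \<in> lin_span y {..<n}" .
  then have "z {} \<in> lin_span y {..<n}"
  proof (induction N)
    case (Suc N)
    then show ?case using reg[of n "y n ^ N * z {}"] 0(1) by (simp add: mult.assoc)
  qed simp
  then show ?case
    by (intro exI[of _ "\<lambda>_. 0"]) (auto simp: koszul_d_def dest: finite_subset)
next
  case (Suc i n z)
  let ?B = "\<lambda>z. \<exists>w. \<forall>S. S \<subseteq> {..<k} \<and> card S = Suc i \<longrightarrow> z S - koszul_d x w S \<in> lin_span y {..<n}"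
  note J = is_ideal_lin_span[of y "{..<n}"]
  have fin: "finite S" if "S \<subseteq> {..<k}" for S using that by (rule finite_subset) simp
  \<comment> \<open>Division by \<open>y n\<close>: \<open>w\<close> is a cocycle modulo
    \<open>y 0, ..., y n\<close>, so the induction hypothesis, usable because
    \<open>Suc n + i = n + Suc i\<close>, writes it as \<open>koszul_d x v + y n * t\<close> up to
    the smaller ideal. The differential of this is \<open>y n * koszul_d x t\<close>, and regularity
    cancels \<open>y n\<close>.\<close>
  have step: "?B u" if "?B (\<lambda>S. y n * u S)" for u
  proof -
    from that obtain w where w: "\<And>S. S \<subseteq> {..<k} \<Longrightarrow> card S = Suc i \<Longrightarrow>
        y n * u S - koszul_d x w S \<in> lin_span y {..<n}" by blast
    have "koszul_d x w T \<in> lin_span y {..<Suc n}" if T: "T \<subseteq> {..<k}" "card T = Suc i" for T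
    proof -
      obtain c where c: "y n * u T - koszul_d x w T = (\<Sum>i<n. c i * y i)"
        using w[OF T] by (rule lin_spanE)
      have "koszul_d x w T = (\<Sum>i<Suc n. (if i = n then u T else - c i) * y i)"
        using c by (simp add: sum_negf algebra_simps)
      then show ?thesis by (rule lin_spanI)
    qed
    with Suc.IH[of "Suc n" w] Suc.prems(1) obtain v where
      v: "\<And>S. S \<subseteq> {..<k} \<Longrightarrow> card S = i \<Longrightarrow> w S - koszul_d x v S \<in> lin_span y {..<Suc n}"
      by auto
    have "\<exists>t. w S - koszul_d x v S - y n * t \<in> lin_span y {..<n}" if S: "S \<subseteq> {..<k}" "card S = i" for S
    proof -
      obtain c where "w S - koszul_d x v S = (\<Sum>i<Suc n. c i * y i)"
        using v[OF S] by (rule lin_spanE)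
      then have "w S - koszul_d x v S - y n * c n = (\<Sum>i<n. c i * y i)"
        by (simp add: algebra_simps)
      then show ?thesis unfolding lin_span_iff by blast
    qed
    then obtain t where t: "\<And>S. S \<subseteq> {..<k} \<Longrightarrow> card S = i \<Longrightarrow>
        w S - koszul_d x v S - y n * t S \<in> lin_span y {..<n}" by metis
    have "u S - koszul_d x t S \<in> lin_span y {..<n}" if S: "S \<subseteq> {..<k}" "card S = Suc i" for S
    proof -
      have "w (S - {j}) - koszul_d x v (S - {j}) - y n * t (S - {j}) \<in> lin_span y {..<n}"
        if "j \<in> S" for j using that S fin by (intro t) auto
      then have "koszul_d x (\<lambda>S. w S + (- 1) * koszul_d x v S + (- y n) * t S) S \<in> lin_span y {..<n}"
        by (intro koszul_d_mem J) simp
      then have "koszul_d x w S - y n * koszul_d x t S \<in> lin_span y {..<n}"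
        unfolding koszul_d_add koszul_d_mult koszul_d_d[OF fin[OF S(1)]] by simp
      from lin_span_add[OF w[OF S] this]
      have "y n * (u S - koszul_d x t S) \<in> lin_span y {..<n}" by (simp add: algebra_simps)
      from reg[OF _ this] show ?thesis using Suc.prems(1) by simp
    qed
    then show "?B u" by blast
  qed
  obtain N where "y n ^ N \<in> lin_span x {..<k}" using rad[of n] Suc.prems(1) by auto
  then obtain c where yN: "y n ^ N = (\<Sum>j<k. c j * x j)" by (rule lin_spanE)
  \<comment> \<open>With \<open>y n ^ N\<close> written as a combination of the \<open>x j\<close>,
    the homotopy formula yields a primitive of \<open>y n ^ N * z\<close> modulo the ideal.\<close>
  have "y n ^ N * z S - koszul_d x (\<lambda>S. \<Sum>j<k. c j * koszul_s j z S) S \<in> lin_span y {..<n}"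
    if S: "S \<subseteq> {..<k}" "card S = Suc i" for S
  proof -
    have "y n ^ N * z S = (\<Sum>j<k. c j * (koszul_d x (koszul_s j z) S + koszul_s j (koszul_d x z) S))"
      unfolding koszul_homotopy[OF fin[OF S(1)]] yN by (simp add: sum_distrib_right mult.assoc)
    then have "y n ^ N * z S - koszul_d x (\<lambda>S. \<Sum>j<k. c j * koszul_s j z S) S
        = (\<Sum>j<k. c j * koszul_s j (koszul_d x z) S)"
      unfolding koszul_d_sum koszul_d_mult by (simp add: sum.distrib distrib_left)
    also have "\<dots> \<in> lin_span y {..<n}"
    proof (intro is_ideal_sum J lin_span_mult)
      fix j assume "j \<in> {..<k}"
      then show "koszul_s j (koszul_d x z) S \<in> lin_span y {..<n}"
        using S fin[OF S(1)] Suc.prems(2)[of "insert j S"]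
        by (auto simp: koszul_s_def intro: lin_span_0 lin_span_mult)
    qed
    finally show ?thesis .
  qed
  then have "?B (\<lambda>S. y n ^ N * z S)" by blast
  then show "?B z"
  proof (induction N)
    case (Suc N)
    then show ?case using step[of "\<lambda>S. y n ^ N * z S"] by (simp add: mult.assoc)
  qed simp
qed

text \<open>This is the vanishing of the Koszul cohomology in degree \<open>d - 1\<close>: a relation
  \<open>\<Sum> x\<^sub>l v\<^sub>l = 0\<close> is a cocycle whose value at \<open>{..<d} - {l}\<close> is \<open>\<plusminus> v\<^sub>l\<close>.\<close>

lemma regular_exchange:
  fixes x y :: "nat \<Rightarrow> 'a::comm_ring_1"
  assumes reg: "\<And>i u. i < d \<Longrightarrow> y i * u \<in> lin_span y {..<i} \<Longrightarrow> u \<in> lin_span y {..<i}"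
    and rad: "\<And>i. i < d \<Longrightarrow> \<exists>N. y i ^ N \<in> lin_span x {..<d}"
    and "j < d" and u: "x j * u \<in> lin_span x ({..<d} - {j})"
  shows "u \<in> lin_span x ({..<d} - {j})"
proof -
  obtain c where c: "x j * u = (\<Sum>l\<in>{..<d} - {j}. c l * x l)" using u by (rule lin_spanE)
  define v where "v l = (if l = j then u else - c l)" for l
  \<comment> \<open>The complement of a set of size \<open>d - 1\<close> is a single index, so there
    the sum picks out one signed \<open>v l\<close>.\<close>
  define z where "z S = (\<Sum>l\<in>{..<d} - S. sgn_in l {..<d} * v l)" for S
  have z: "z ({..<d} - {l}) = sgn_in l {..<d} * v l" if "l < d" for l
  proof -
    have "{..<d} - ({..<d} - {l}) = {l}" using that by auto
    then show ?thesis by (simp add: z_def)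
  qed
  have "koszul_d x z {..<d} = (\<Sum>l<d. x l * v l)"
    unfolding koszul_d_def by (intro sum.cong refl) (simp add: z ac_simps)
  also have "\<dots> = x j * u + (\<Sum>l\<in>{..<d} - {j}. x l * v l)"
    using \<open>j < d\<close> by (subst sum.remove[of _ j]) (auto simp: v_def)
  also have "(\<Sum>l\<in>{..<d} - {j}. x l * v l) = - (\<Sum>l\<in>{..<d} - {j}. c l * x l)"
    unfolding sum_negf[symmetric] by (intro sum.cong refl) (auto simp: v_def)
  finally have cyc: "koszul_d x z {..<d} = 0" using c by simp
  \<comment> \<open>Here \<open>n = 0\<close>, and \<open>lin_span y {..<0}\<close> is zero, so
    \<open>z\<close> is an honest coboundary in degree \<open>d - 1\<close>.\<close>
  have "\<exists>w. \<forall>S. S \<subseteq> {..<d} \<and> card S = d - 1 \<longrightarrow> z S - koszul_d x w S \<in> lin_span y {..<0}"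
  proof (rule koszul_exact[of d])
    fix T assume "T \<subseteq> {..<d}" "card T = Suc (d - 1)"
    then have "T = {..<d}" using \<open>j < d\<close> by (intro card_subset_eq) auto
    then show "koszul_d x z T \<in> lin_span y {..<0}" using cyc by (simp add: lin_span_0)
  qed (use reg rad \<open>j < d\<close> in auto)
  then obtain w where w: "\<And>S. S \<subseteq> {..<d} \<Longrightarrow> card S = d - 1 \<Longrightarrow> z S - koszul_d x w S \<in> lin_span y {..<0}"
    by blast
  have "z ({..<d} - {j}) - koszul_d x w ({..<d} - {j}) \<in> lin_span y {..<0}"
    using \<open>j < d\<close> by (intro w) auto
  then have "sgn_in j {..<d} * u = koszul_d x w ({..<d} - {j})"
    using z[OF \<open>j < d\<close>] by (simp add: lin_span_def v_def)
  also have "\<dots> \<in> lin_span x ({..<d} - {j})"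
    unfolding koszul_d_def
    by (rule lin_spanI[where c = "\<lambda>l. sgn_in l ({..<d} - {j}) * w ({..<d} - {j} - {l})"])
       (simp add: ac_simps)
  finally have "sgn_in j {..<d} * (sgn_in j {..<d} * u) \<in> lin_span x ({..<d} - {j})"
    by (rule lin_span_mult)
  then show ?thesis by simp
qed

section \<open>Top local cohomology as a limit of quotients by powers of the parameters\<close>

text \<open>Mixed exponents are allowed because the socle computation lowers the exponents of the
  parameters one at a time.\<close>

locale cancellable_params =
  fixes a :: "nat \<Rightarrow> 'a::comm_ring_1" and d :: nat
  assumes cancel: "j < d \<Longrightarrow> a j * u \<in> lin_span (\<lambda>i. a i ^ f i) ({..<d} - {j}) \<Longrightarrow>
    u \<in> lin_span (\<lambda>i. a i ^ f i) ({..<d} - {j})"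
begin

definition power_ideal :: "(nat \<Rightarrow> nat) \<Rightarrow> 'a set" where
  "power_ideal f = lin_span (\<lambda>i. a i ^ f i) {..<d}"

lemma is_ideal_power_ideal: "is_ideal (power_ideal f)"
  by (simp add: power_ideal_def is_ideal_lin_span)

lemmas power_ideal_add = is_ideal_add[OF is_ideal_power_ideal]
lemmas power_ideal_mult = is_ideal_mult[OF is_ideal_power_ideal]

lemma power_ideal_generator: "i < d \<Longrightarrow> f i \<le> n \<Longrightarrow> r * a i ^ n \<in> power_ideal f"
  using lin_span_generator[of "{..<d}" i "\<lambda>i. a i ^ f i"]
    power_ideal_mult[of "a i ^ f i" f "r * a i ^ (n - f i)"]
  by (simp add: power_ideal_def mult.assoc flip: power_add)

text \<open>Subtracting the multiple of \<open>a j ^ k\<close> hidden in the \<open>j\<close>-th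
  term leaves a relation modulo the other powers, where \<open>a j\<close> cancels.\<close>

lemma power_ideal_cancel_Suc:
  assumes "j < d" "a j * u \<in> power_ideal (f(j := Suc k))"
  shows "u \<in> power_ideal (f(j := k))"
proof -
  let ?L = "lin_span (\<lambda>i. a i ^ f i) ({..<d} - {j})"
  obtain c where "a j * u = (\<Sum>i<d. c i * a i ^ (f(j := Suc k)) i)"
    using assms(2) unfolding power_ideal_def by (rule lin_spanE)
  also have "\<dots> = c j * a j ^ Suc k + (\<Sum>i\<in>{..<d} - {j}. c i * a i ^ (f(j := Suc k)) i)"
    using assms(1) by (subst sum.remove[of _ j]) auto
  also have "(\<Sum>i\<in>{..<d} - {j}. c i * a i ^ (f(j := Suc k)) i) = (\<Sum>i\<in>{..<d} - {j}. c i * a i ^ f i)"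
    by (intro sum.cong) auto
  finally have "a j * (u - c j * a j ^ k) = (\<Sum>i\<in>{..<d} - {j}. c i * a i ^ f i)"
    by (simp add: algebra_simps)
  then have "a j * (u - c j * a j ^ k) \<in> ?L" by (rule lin_spanI)
  then have "u - c j * a j ^ k \<in> ?L" by (rule cancel[OF assms(1)])
  also have "?L \<subseteq> power_ideal (f(j := k))"
  proof (rule lin_span_least[OF is_ideal_power_ideal])
    fix i assume "i \<in> {..<d} - {j}"
    then show "a i ^ f i \<in> power_ideal (f(j := k))"
      using power_ideal_generator[of i "f(j := k)" "f i" 1] by simp
  qed
  finally have "u - c j * a j ^ k \<in> power_ideal (f(j := k))" .
  moreover have "c j * a j ^ k \<in> power_ideal (f(j := k))"
    using assms(1) by (intro power_ideal_generator) auto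
  ultimately have "u - c j * a j ^ k + c j * a j ^ k \<in> power_ideal (f(j := k))"
    by (rule power_ideal_add)
  then show ?thesis by simp
qed

lemma power_ideal_cancel_power:
  assumes "j < d" "a j ^ e * u \<in> power_ideal (f(j := e + f j))"
  shows "u \<in> power_ideal f"
  using assms(2)
proof (induction e)
  case (Suc e)
  have "a j * (a j ^ e * u) \<in> power_ideal (f(j := Suc (e + f j)))"
    using Suc.prems by (simp only: power_Suc mult.assoc add_Suc)
  then show ?case using power_ideal_cancel_Suc[OF assms(1)] Suc.IH by blast
qed simp

lemma power_ideal_cancel_prodS:
  assumes "B \<subseteq> {..<d}" "prodS a B ^ e * u \<in> power_ideal (\<lambda>i. if i \<in> B then e + f i else f i)"
  shows "u \<in> power_ideal f"
proof -
  have "finite B" using assms(1) by (rule finite_subset) simp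
  then show ?thesis using assms
  proof (induction B arbitrary: u)
    case (insert j B)
    let ?h = "\<lambda>i. if i \<in> B then e + f i else f i"
    have "(\<lambda>i. if i \<in> insert j B then e + f i else f i) = ?h(j := e + ?h j)"
      using insert.hyps by auto
    then have "a j ^ e * (prodS a B ^ e * u) \<in> power_ideal (?h(j := e + ?h j))"
      using insert.prems(2) insert.hyps by (simp add: prodS_def power_mult_distrib mult.assoc)
    then have "prodS a B ^ e * u \<in> power_ideal ?h"
      using insert.prems(1) power_ideal_cancel_power[of j e "prodS a B ^ e * u" ?h] by simp
    then show ?case using insert.IH insert.prems(1) by simp
  qed (simp add: prodS_def)
qed

section \<open>The direct system of quotients by equal powers of the parameters\<close>

abbreviation "A \<equiv> prodS a {..<d}"

definition Q :: "nat \<Rightarrow> 'a set" where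
  "Q n = power_ideal (\<lambda>_. n)"

lemma is_ideal_Q: "is_ideal (Q n)"
  by (simp add: Q_def is_ideal_power_ideal)

lemmas Q_add = is_ideal_add[OF is_ideal_Q]
lemmas Q_diff = is_ideal_diff[OF is_ideal_Q]
lemmas Q_mult = is_ideal_mult[OF is_ideal_Q]
lemmas Q_0 = is_ideal_0[OF is_ideal_Q]

lemma Q_generator: "i < d \<Longrightarrow> n \<le> k \<Longrightarrow> r * a i ^ k \<in> Q n"
  by (simp add: Q_def power_ideal_generator)

lemma QI: "u = (\<Sum>i<d. c i * a i ^ n) \<Longrightarrow> u \<in> Q n"
  unfolding Q_def power_ideal_def by (rule lin_spanI)

lemma QE:
  assumes "u \<in> Q n"
  obtains c where "u = (\<Sum>i<d. c i * a i ^ n)"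
  using assms unfolding Q_def power_ideal_def by (rule lin_spanE)

text \<open>Multiplication by \<open>A ^ e\<close> is the transition map from \<open>R / Q n\<close>
  to \<open>R / Q (e + n)\<close> in the direct system with limit \<open>H\<close>; cancellation
  makes it injective.\<close>

lemma Q_shift: "A ^ e * u \<in> Q (e + n) \<longleftrightarrow> u \<in> Q n"
proof
  assume "A ^ e * u \<in> Q (e + n)"
  also have "Q (e + n) \<subseteq> power_ideal (\<lambda>i. if i \<in> {..<d} then e + n else n)"
    unfolding Q_def power_ideal_def
    by (intro lin_span_least is_ideal_lin_span)
      (use power_ideal_generator[where f = "\<lambda>i. if i < d then e + n else n" and r = 1 and n = "e + n"]
        in \<open>auto simp: power_ideal_def\<close>)
  finally show "u \<in> Q n"
    unfolding Q_def using power_ideal_cancel_prodS[of "{..<d}" e u "\<lambda>_. n"] by simp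
next
  assume "u \<in> Q n"
  then obtain c where "u = (\<Sum>i<d. c i * a i ^ n)" by (rule QE)
  then have "A ^ e * u = (\<Sum>i<d. c i * (A ^ e * a i ^ n))"
    by (simp add: sum_distrib_left ac_simps)
  also have "\<dots> \<in> Q (e + n)"
  proof (rule is_ideal_sum[OF is_ideal_Q], rule Q_mult)
    fix i assume "i \<in> {..<d}"
    then have "A = a i * prodS a ({..<d} - {i})"
      by (simp add: prodS_def prod.remove)
    then have "A ^ e * a i ^ n = prodS a ({..<d} - {i}) ^ e * a i ^ (e + n)"
      by (simp add: power_mult_distrib power_add ac_simps)
    then show "A ^ e * a i ^ n \<in> Q (e + n)" using \<open>i \<in> {..<d}\<close> by (simp add: Q_generator)
  qed
  finally show "A ^ e * u \<in> Q (e + n)" .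
qed

text \<open>Since the transition maps are injective, a fraction that dies in the limit dies already
  at its own stage \<open>n\<close>.\<close>

lemma H_zero_iff: "H_zero a d r n \<longleftrightarrow> r \<in> Q n"
proof -
  have S: "S \<subseteq> {..<d} \<and> card S = d \<longleftrightarrow> S = {..<d}" for S
    using card_subset_eq[of "{..<d}" S] by auto
  let ?D = "\<lambda>y m. \<Sum>j<d. sgn_in j {..<d} * y ({..<d} - {j}) * a j ^ m"
  have "H_zero a d r n \<longleftrightarrow> (\<exists>y m t. A ^ t * (r * A ^ m - ?D y m * A ^ n) = 0)"
    unfolding H_zero_def cech_coboundary_def S by simp
  also have "\<dots> \<longleftrightarrow> r \<in> Q n"
  proof
    assume "\<exists>y m t. A ^ t * (r * A ^ m - ?D y m * A ^ n) = 0"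
    then obtain y m t where "A ^ t * (r * A ^ m - ?D y m * A ^ n) = 0" by blast
    then have "A ^ (t + m) * r = A ^ (t + n) * ?D y m"
      by (simp add: power_add algebra_simps)
    also have "\<dots> \<in> Q (t + n + m)" by (simp add: Q_shift QI)
    finally show "r \<in> Q n" using Q_shift[of "t + m" r n] by (simp add: ac_simps)
  next
    assume "r \<in> Q n"
    then obtain c where c: "r = (\<Sum>i<d. c i * a i ^ n)" by (rule QE)
    \<comment> \<open>The value at the set missing \<open>j\<close> is the signed coefficient
      \<open>c j\<close>; its sign cancels that of the differential.\<close>
    let ?y = "\<lambda>S. \<Sum>j\<in>{..<d} - S. sgn_in j {..<d} * c j"
    have "?D ?y n = r" unfolding c
    proof (rule sum.cong[OF refl])
      fix j assume "j \<in> {..<d}"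
      then have "{..<d} - ({..<d} - {j}) = {j}" by auto
      then show "sgn_in j {..<d} * ?y ({..<d} - {j}) * a j ^ n = c j * a j ^ n" by simp
    qed
    then have "A ^ 0 * (r * A ^ n - ?D ?y n * A ^ n) = 0" by simp
    then show "\<exists>y m t. A ^ t * (r * A ^ m - ?D y m * A ^ n) = 0"
      by (intro exI[of _ ?y] exI[of _ n] exI[of _ 0])
  qed
  finally show ?thesis .
qed

lemma H_eq_iff: "H_eq a d (r, n) (s, k) \<longleftrightarrow> r * A ^ k - s * A ^ n \<in> Q (n + k)"
  by (simp add: H_eq_def H_zero_iff)

text \<open>The socle computation in \<open>R / (a\<^sub>1\<^sup>k, \<dots>, a\<^sub>d\<^sup>k)\<close> shows that an element of \<open>H\<close> killed by
  \<open>q\<close> has a representative with denominator \<open>a\<^sub>1 \<cdots> a\<^sub>d\<close>.\<close>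

lemma colon_Q:
  assumes "\<And>i. i < d \<Longrightarrow> a i * u \<in> Q (Suc k)"
  shows "\<exists>b. u - A ^ k * b \<in> Q (Suc k)"
proof -
  have "\<exists>b. u - prodS a {..<i} ^ k * b \<in> Q (Suc k)" if "i \<le> d" for i
    using that
  proof (induction i)
    case 0
    show ?case by (rule exI[of _ u]) (simp add: prodS_def Q_0)
  next
    case (Suc i)
    \<comment> \<open>Indices below \<open>i\<close> are done: dividing by \<open>?B ^ k\<close>
      lowers their exponent from \<open>Suc k\<close> to \<open>1\<close>, while the others stay at
      \<open>Suc k\<close>.\<close>
    let ?B = "prodS a {..<i}" and ?f = "\<lambda>l. if l < i then 1 else Suc k"
    obtain b where b: "u - ?B ^ k * b \<in> Q (Suc k)" using Suc by auto
    have "a i * u - a i * (u - ?B ^ k * b) \<in> Q (Suc k)"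
      using assms[of i] Suc.prems Q_diff Q_mult[OF b] by simp
    then have "?B ^ k * (a i * b) \<in> power_ideal (\<lambda>_. Suc k)"
      by (simp add: Q_def algebra_simps)
    moreover have "(\<lambda>l. if l \<in> {..<i} then k + ?f l else ?f l) = (\<lambda>_. Suc k)" by auto
    ultimately have "a i * b \<in> power_ideal ?f"
      using Suc.prems power_ideal_cancel_prodS[of "{..<i}" k "a i * b" ?f] by auto
    moreover have "?f = ?f(i := Suc k)" by auto
    ultimately have "b \<in> power_ideal (?f(i := k))"
      using Suc.prems power_ideal_cancel_Suc[of i b ?f k] by simp
    \<comment> \<open>The \<open>i\<close>-th term supplies the next factor \<open>a i ^ k\<close>.
      The other terms land in \<open>Q (Suc k)\<close> after multiplication by
      \<open>?B ^ k\<close>, which restores the exponent \<open>Suc k\<close> for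
      \<open>l < i\<close>.\<close>
    then obtain c where "b = (\<Sum>l<d. c l * a l ^ (?f(i := k)) l)"
      unfolding power_ideal_def by (rule lin_spanE)
    then have "b = c i * a i ^ k + (\<Sum>l\<in>{..<d} - {i}. c l * a l ^ (?f(i := k)) l)"
      using Suc.prems by (subst (asm) sum.remove[of _ i]) auto
    then have "?B ^ k * b - (?B * a i) ^ k * c i
        = (\<Sum>l\<in>{..<d} - {i}. c l * (?B ^ k * a l ^ (?f(i := k)) l))"
      by (simp add: distrib_left sum_distrib_left power_mult_distrib mult.assoc mult.left_commute)
    also have "\<dots> \<in> Q (Suc k)"
    proof (intro is_ideal_sum is_ideal_Q Q_mult[of "_ * _"])
      fix l assume l: "l \<in> {..<d} - {i}"
      show "?B ^ k * a l ^ (?f(i := k)) l \<in> Q (Suc k)"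
      proof (cases "l < i")
        case True
        then have "?B = prodS a ({..<i} - {l}) * a l" by (simp add: prodS_def prod.remove ac_simps)
        then have "?B ^ k * a l ^ (?f(i := k)) l = prodS a ({..<i} - {l}) ^ k * a l ^ Suc k"
          using True by (simp add: power_mult_distrib ac_simps)
        then show ?thesis
          using l Q_generator[of l "Suc k" "Suc k" "prodS a ({..<i} - {l}) ^ k"] by simp
      next
        case False
        then show ?thesis using l Q_generator[of l "Suc k" "Suc k" "?B ^ k"] by simp
      qed
    qed
    finally have "u - (?B * a i) ^ k * c i \<in> Q (Suc k)"
      using Q_add[OF b] by fastforce
    then show ?case by (auto simp: prodS_def)
  qed
  from this[of d] show ?thesis by simp
qed

text \<open>Each parameter is nilpotent modulo \<open>Q k\<close>. Multiplying in turn by its last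
  power that keeps the element nonzero preserves annihilation by the earlier parameters.\<close>

lemma exists_socle_multiple:
  assumes "s \<notin> Q k"
  shows "\<exists>t. t * s \<notin> Q k \<and> (\<forall>i<d. a i * (t * s) \<in> Q k)"
proof -
  have "\<exists>t. t * s \<notin> Q k \<and> (\<forall>i<n. a i * (t * s) \<in> Q k)" if "n \<le> d" for n
    using that
  proof (induction n)
    case 0
    show ?case using assms by (intro exI[of _ 1]) simp
  next
    case (Suc n)
    then obtain t where t: "t * s \<notin> Q k" "\<And>i. i < n \<Longrightarrow> a i * (t * s) \<in> Q k" by auto
    define P where "P e \<longleftrightarrow> a n ^ e * (t * s) \<in> Q k" for e
    have "P k" unfolding P_def using Q_generator[of n k k "t * s"] Suc.prems by (simp add: ac_simps)
    moreover have "\<not> P 0" using t by (simp add: P_def)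
    ultimately obtain e where e: "\<not> P e" "P (Suc e)"
      using nat_induct[of "\<lambda>e. \<not> P e" k] by blast
    have "a i * (a n ^ e * t * s) \<in> Q k" if "i < Suc n" for i
    proof (cases "i = n")
      case True
      then show ?thesis using e(2) by (simp add: P_def mult.assoc)
    next
      case False
      then show ?thesis using Q_mult[OF t(2)[of i], of "a n ^ e"] that by (simp add: ac_simps)
    qed
    then show ?case using e(1) by (intro exI[of _ "a n ^ e * t"]) (simp add: P_def mult.assoc)
  qed
  from this[of d] show ?thesis by simp
qed

end

section \<open>The Frobenius action on top local cohomology\<close>

text \<open>The last assumption is injectivity of Frobenius on \<open>H\<close>, read on
  representatives through \<open>H_zero_iff\<close>.\<close>

locale frobenius_injective_params = cancellable_params a d
  for a :: "nat \<Rightarrow> 'a::comm_ring_1" and d :: nat +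
  fixes p :: nat
  assumes prime_p: "prime p" and char_p: "CHAR('a) = p"
    and frobenius_inj: "u ^ p \<in> Q (n * p) \<Longrightarrow> u \<in> Q n"
begin

lemma add_power_p: "((u::'a) + v) ^ p ^ e = u ^ p ^ e + v ^ p ^ e"
  using freshmans_dream'[of "p ^ e" e u v] prime_p char_p by simp

lemma diff_power_p: "((u::'a) - v) ^ p ^ e = u ^ p ^ e - v ^ p ^ e"
  using add_power_p[of "u - v" v e] by (simp add: algebra_simps)

lemma zero_power_p: "(0::'a) ^ p ^ e = 0"
  using prime_gt_0_nat[OF prime_p] by (simp add: zero_power)

lemma Q_power_p:
  assumes "u \<in> Q n"
  shows "u ^ p ^ e \<in> Q (n * p ^ e)"
proof -
  obtain c where "u = (\<Sum>i<d. c i * a i ^ n)" using assms by (rule QE)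
  then have "u ^ p ^ e = (\<Sum>i<d. c i ^ p ^ e * a i ^ (n * p ^ e))"
    using freshmans_dream_sum'[of "p ^ e" e "\<lambda>i. c i * a i ^ n" "{..<d}"] prime_p char_p
    by (simp add: power_mult_distrib power_mult)
  then show ?thesis by (rule QI)
qed

text \<open>Taking \<open>p ^ e\<close>-th powers is additive in characteristic \<open>p\<close>, so
  the powers of the generators already generate.\<close>

lemma frob_power_eq: "frob_power (lin_span a {..<d}) p e = Q (p ^ e)"
proof
  have "lin_span a {..<d} = Q 1" by (simp add: Q_def power_ideal_def)
  then show "frob_power (lin_span a {..<d}) p e \<subseteq> Q (p ^ e)"
    unfolding frob_power_def using Q_power_p[of _ 1 e] by (intro ideal_gen_least is_ideal_Q) auto
  have "a i ^ p ^ e \<in> frob_power (lin_span a {..<d}) p e" if "i < d" for i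
    unfolding frob_power_def using that lin_span_generator[of "{..<d}" i a]
    by (intro subsetD[OF ideal_gen_superset]) auto
  then show "Q (p ^ e) \<subseteq> frob_power (lin_span a {..<d}) p e"
    unfolding Q_def power_ideal_def frob_power_def by (intro lin_span_least is_ideal_ideal_gen) auto
qed

abbreviation "q \<equiv> lin_span a {..<d}"

lemma Q_1: "Q 1 = q"
  by (simp add: Q_def power_ideal_def)

text \<open>By injectivity of Frobenius, \<open>c x\<^sup>n h = 0\<close> follows from \<open>c x\<^sup>n\<^sup>+\<^sup>1 h = 0\<close>, because the latter
  gives \<open>x (c x\<^sup>n h) = 0\<close>.\<close>

lemma q_of_iff: "c \<in> q_of p q b \<longleftrightarrow> (\<forall>e. c * b ^ p ^ e \<in> Q (p ^ e))"
proof
  assume "c \<in> q_of p q b"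
  then obtain e0 where e0: "\<And>e. e \<ge> e0 \<Longrightarrow> c * b ^ p ^ e \<in> Q (p ^ e)"
    unfolding q_of_def frob_power_eq by blast
  show "\<forall>e. c * b ^ p ^ e \<in> Q (p ^ e)"
  proof
    fix e
    have step: "c * b ^ p ^ e \<in> Q (p ^ e)" if "c * b ^ p ^ Suc e \<in> Q (p ^ Suc e)" for e
    proof -
      \<comment> \<open>The factor \<open>c ^ (p - 1)\<close> completes \<open>c\<close> to a
        \<open>p\<close>-th power and so produces the Frobenius image of
        \<open>c * b ^ p ^ e\<close>.\<close>
      have "c ^ p = c ^ (p - 1) * c" using power_minus_mult[OF prime_gt_0_nat[OF prime_p], of c] by simp
      then have "(c * b ^ p ^ e) ^ p = c ^ (p - 1) * (c * b ^ p ^ Suc e)"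
        by (simp add: power_mult_distrib ac_simps flip: power_mult)
      then have "(c * b ^ p ^ e) ^ p \<in> Q (p ^ e * p)"
        using Q_mult[OF that, of "c ^ (p - 1)"] by (simp only: power_Suc2)
      then show ?thesis by (rule frobenius_inj)
    qed
    show "c * b ^ p ^ e \<in> Q (p ^ e)"
    proof (cases "e0 \<le> e")
      case False
      then have "e \<le> e0" by simp
      then show ?thesis
        by (induction rule: inc_induct) (use e0 step in blast)+
    qed (rule e0)
  qed
qed (auto simp: q_of_def frob_power_eq)

lemma is_ideal_q_of: "is_ideal (q_of p q b)"
  unfolding is_ideal_def
  by (auto simp: q_of_iff Q_0 distrib_right mult.assoc intro: Q_add Q_mult)

lemma q_of_proper: "b \<notin> q \<Longrightarrow> q_of p q b \<noteq> UNIV"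
  using q_of_iff[of 1 b] Q_1 by (metis UNIV_I mult_1 power_0 power_one_right)

text \<open>These are the elements killed by \<open>c x^e\<close> for all \<open>c\<close> in
  \<open>I\<close> and all \<open>e\<close>. Closure under \<open>x\<close> shifts \<open>e\<close>
  by one; independence of the representative comes from a common denominator and
  \<open>Q_shift\<close>.\<close>

lemma H_annihilator_submodule:
  "H_Rxf_submodule p a d {(s, k). \<forall>c\<in>I. \<forall>e. c * s ^ p ^ e \<in> Q (k * p ^ e)}" (is "H_Rxf_submodule _ _ _ ?N")
  unfolding H_Rxf_submodule_def
proof (intro conjI allI impI)
  show "(0, 0) \<in> ?N" by (simp add: zero_power_p Q_0)
next
  fix x y assume xy: "x \<in> ?N \<and> H_eq a d x y"
  obtain r n s k where [simp]: "x = (r, n)" "y = (s, k)" by (metis surj_pair)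
  have "c * s ^ p ^ e \<in> Q (k * p ^ e)" if "c \<in> I" for c e
  proof -
    have "(r * A ^ k - s * A ^ n) ^ p ^ e \<in> Q ((n + k) * p ^ e)"
      using xy by (intro Q_power_p) (simp add: H_eq_iff)
    then have "c * (r * A ^ k - s * A ^ n) ^ p ^ e \<in> Q ((n + k) * p ^ e)" by (rule Q_mult)
    moreover have "A ^ (k * p ^ e) * (c * r ^ p ^ e) \<in> Q (k * p ^ e + n * p ^ e)"
      using xy that by (simp add: Q_shift)
    ultimately have "A ^ (k * p ^ e) * (c * r ^ p ^ e) - c * (r * A ^ k - s * A ^ n) ^ p ^ e
        \<in> Q (n * p ^ e + k * p ^ e)"
      by (intro Q_diff) (simp_all add: algebra_simps)
    also have "A ^ (k * p ^ e) * (c * r ^ p ^ e) - c * (r * A ^ k - s * A ^ n) ^ p ^ e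
        = A ^ (n * p ^ e) * (c * s ^ p ^ e)"
      by (simp add: diff_power_p power_mult_distrib power_mult algebra_simps)
    finally show ?thesis by (simp add: Q_shift)
  qed
  then show "y \<in> ?N" by simp
next
  fix r n s k assume *: "(r, n) \<in> ?N \<and> (s, k) \<in> ?N"
  have "c * (r * A ^ k + s * A ^ n) ^ p ^ e \<in> Q ((n + k) * p ^ e)" if "c \<in> I" for c e
  proof -
    have "A ^ (k * p ^ e) * (c * r ^ p ^ e) \<in> Q (k * p ^ e + n * p ^ e)"
      "A ^ (n * p ^ e) * (c * s ^ p ^ e) \<in> Q (n * p ^ e + k * p ^ e)"
      using * that by (simp_all add: Q_shift)
    then have "A ^ (k * p ^ e) * (c * r ^ p ^ e) + A ^ (n * p ^ e) * (c * s ^ p ^ e)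
        \<in> Q ((n + k) * p ^ e)"
      by (intro Q_add) (simp_all add: algebra_simps)
    then show ?thesis
      by (simp add: add_power_p power_mult_distrib power_mult algebra_simps)
  qed
  then show "(r * A ^ k + s * A ^ n, n + k) \<in> ?N" by simp
next
  fix t r n assume "(r, n) \<in> ?N"
  \<comment> \<open>This is the commutation rule \<open>x^e t = t^(p^e) x^e\<close>.\<close>
  then have "t ^ p ^ e * (c * r ^ p ^ e) \<in> Q (n * p ^ e)" if "c \<in> I" for c e
    using that by (auto intro: Q_mult[of "c * r ^ p ^ e"])
  then show "(t * r, n) \<in> ?N"
    by (simp add: power_mult_distrib mult.left_commute)
next
  fix r n assume "(r, n) \<in> ?N"
  then have "c * r ^ p ^ Suc e \<in> Q (n * p ^ Suc e)" if "c \<in> I" for c e using that by blast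
  then show "(r ^ p, n * p) \<in> ?N" by (simp add: power_mult mult.assoc)
qed

lemma q_of_in_I_H: "q_of p q b \<in> I_H p a d"
proof -
  \<comment> \<open>the largest submodule killed by \<open>q_of p q b\<close> in all degrees, instead of \<open>R[x,f] [b / A]\<close>\<close>
  define N where "N = {(s, k). \<forall>c\<in>q_of p q b. \<forall>e. c * s ^ p ^ e \<in> Q (k * p ^ e)}"
  \<comment> \<open>The pair represents \<open>x^l [b / A]\<close>.\<close>
  have N: "(b ^ p ^ l, p ^ l) \<in> N" for l
    by (auto simp: N_def q_of_iff simp flip: power_mult power_add)
  have "grann_deg p a d N e = q_of p q b" for e
  proof
    show "q_of p q b \<subseteq> grann_deg p a d N e"
      by (auto simp: grann_deg_def N_def H_zero_iff)
    show "grann_deg p a d N e \<subseteq> q_of p q b"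
    proof
      fix c assume "c \<in> grann_deg p a d N e"
      then have "c * (b ^ p ^ l) ^ p ^ e \<in> Q (p ^ l * p ^ e)" for l
        using N unfolding grann_deg_def H_zero_iff by blast
      then have *: "c * b ^ p ^ (l + e) \<in> Q (p ^ (l + e))" for l
        by (simp add: power_mult power_add)
      \<comment> \<open>Degree \<open>e\<close> tests only exponents \<open>n >= e\<close>, which
        suffices because \<open>q_of\<close> asks for large \<open>n\<close>.\<close>
      have "c * b ^ p ^ n \<in> Q (p ^ n)" if "n \<ge> e" for n
        using *[of "n - e"] that by simp
      then show "c \<in> q_of p q b" unfolding q_of_def frob_power_eq by blast
    qed
  qed
  moreover have "H_Rxf_submodule p a d N" unfolding N_def by (rule H_annihilator_submodule)
  ultimately show ?thesis unfolding I_H_def using is_ideal_q_of by blast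
qed

lemma I_H_below_q_of:
  assumes "d > 0" "I \<in> I_H p a d" "I \<noteq> UNIV"
  shows "\<exists>b. b \<notin> q \<and> I \<subseteq> q_of p q b"
proof -
  obtain N where N: "H_Rxf_submodule p a d N" and I: "is_ideal I" "\<And>e. grann_deg p a d N e = I"
    using assms(2) by (auto simp: I_H_def)
  have "1 \<notin> I" using I(1) assms(3) unfolding is_ideal_def by (metis UNIV_eq_I mult.right_neutral)
  then have "1 \<notin> grann_deg p a d N 0" by (simp add: I(2))
  then obtain s k where s: "(s, k) \<in> N" "s \<notin> Q k"
    by (auto simp: grann_deg_def H_zero_iff)
  \<comment> \<open>As \<open>d > 0\<close>, \<open>Q 0\<close> is the unit ideal, so a nonzero
    fraction has a positive exponent.\<close>
  have "k \<noteq> 0"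
    using s(2) Q_generator[of 0 0 0 s] assms(1) by (intro notI) simp
  then obtain k' where k: "k = Suc k'" by (cases k) auto
  obtain t where t: "t * s \<notin> Q k" "\<And>i. i < d \<Longrightarrow> a i * (t * s) \<in> Q k"
    using exists_socle_multiple[OF s(2)] by blast
  then obtain b where b: "t * s - A ^ k' * b \<in> Q k" using colon_Q[of "t * s" k'] k by auto
  have bq: "b \<notin> q"
  proof
    assume "b \<in> q"
    then have "A ^ k' * b \<in> Q k" using Q_shift[of k' b 1] Q_1 k by simp
    from Q_add[OF b this] t(1) show False by simp
  qed
  have "(t * s, k) \<in> N" using N s(1) unfolding H_Rxf_submodule_def by blast
  \<comment> \<open>The cross difference of the two fractions is
    \<open>A * (t * s - A ^ k' * b)\<close>.\<close>
  moreover have "H_eq a d (t * s, k) (b, 1)"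
    using Q_shift[of 1 "t * s - A ^ k' * b" k] b k by (simp add: H_eq_iff algebra_simps)
  ultimately have "(b, 1) \<in> N" using N unfolding H_Rxf_submodule_def by blast
  then have "I \<subseteq> q_of p q b"
    using I(2) by (fastforce simp: grann_deg_def H_zero_iff q_of_iff)
  with bq show ?thesis by blast
qed

end

section \<open>Comparison of maximal members and descent to the hypotheses on the ring\<close>

lemma maximal_members_eq:
  assumes "Z \<subseteq> Y" "\<And>I. I \<in> Y \<Longrightarrow> \<exists>J\<in>Z. I \<subseteq> J"
  shows "maximal_members Z = maximal_members Y"
proof (rule set_eqI)
  fix X
  have "I = X" if "\<forall>J\<in>Z. X \<subseteq> J \<longrightarrow> J = X" "I \<in> Y" "X \<subseteq> I" for I
  proof -
    obtain J where "J \<in> Z" "I \<subseteq> J" using assms(2) \<open>I \<in> Y\<close> by blast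
    then show ?thesis using that by blast
  qed
  moreover have "X \<in> Z" if "X \<in> Y" "\<forall>I\<in>Y. X \<subseteq> I \<longrightarrow> I = X"
    using assms that by blast
  ultimately show "X \<in> maximal_members Z \<longleftrightarrow> X \<in> maximal_members Y"
    using assms(1) unfolding maximal_members_def by blast
qed

theorem theorem5p2:
  fixes m :: "'a::comm_ring_1 set" and p d :: nat and a :: "nat \<Rightarrow> 'a"
  assumes "noetherian_local_ring m"
    and "prime p" and "of_nat p = (0::'a)"
    and "cohen_macaulay m d"
    and "F_injective p m"
    and "d > 0"
    and "system_of_parameters m a d"
  shows "maximal_members (Z_set p (ideal_gen (a ` {..<d})))
           = maximal_members (I_H p a d - {UNIV})"
proof -
  have q: "ideal_gen (x ` {..<n}) = lin_span x {..<n}" for x :: "nat \<Rightarrow> 'a" and n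
    by (simp add: ideal_gen_image)
  have "is_ideal m" "m \<noteq> UNIV"
    using assms(1) by (auto simp: noetherian_local_ring_def is_max_ideal_def)
  then have "(1::'a) \<noteq> 0"
    unfolding is_ideal_def by (metis UNIV_eq_I mult_1 mult_zero_left)
  then have "CHAR('a) \<noteq> 1" by (metis of_nat_1 of_nat_CHAR)
  moreover have "CHAR('a) dvd p" using assms(3) by (simp add: of_nat_eq_0_iff_char_dvd)
  ultimately have char: "CHAR('a) = p" using \<open>prime p\<close> by (metis prime_nat_iff)
  have am: "\<And>i. i < d \<Longrightarrow> a i \<in> m" and rad: "\<And>x. x \<in> m \<Longrightarrow> \<exists>e. x ^ e \<in> lin_span a {..<d}"
    using assms(7) by (auto simp: system_of_parameters_def q)
  \<comment> \<open>A \<open>p ^ l\<close>-th power of a combination of the \<open>a i\<close> is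
    taken termwise, and the choice of \<open>l\<close> makes \<open>p ^ l\<close> exceed every
    \<open>f i\<close>.\<close>
  have rad_pow: "\<exists>e. x ^ e \<in> lin_span (\<lambda>i. a i ^ f i) {..<d}" if "x \<in> m" for x f
  proof -
    obtain e c where c: "x ^ e = (\<Sum>i<d. c i * a i)" using rad[OF \<open>x \<in> m\<close>] lin_span_iff by metis
    define l where "l = (\<Sum>i<d. f i)"
    have "f i \<le> p ^ l" if "i < d" for i
    proof -
      have "f i \<le> l" unfolding l_def using that by (intro member_le_sum) auto
      also have "l < p ^ l" using prime_gt_1_nat[OF \<open>prime p\<close>] by (intro power_gt_expt) auto
      finally show ?thesis by simp
    qed
    then have "a i ^ p ^ l = a i ^ (p ^ l - f i) * a i ^ f i" if "i < d" for i
      using that by (simp flip: power_add)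
    then have "(x ^ e) ^ p ^ l = (\<Sum>i<d. (c i ^ p ^ l * a i ^ (p ^ l - f i)) * a i ^ f i)"
      using freshmans_dream_sum'[of "p ^ l" l "\<lambda>i. c i * a i" "{..<d}"] \<open>prime p\<close> char
      unfolding c by (simp add: power_mult_distrib mult.assoc)
    then have "x ^ (e * p ^ l) \<in> lin_span (\<lambda>i. a i ^ f i) {..<d}"
      unfolding power_mult by (rule lin_spanI)
    then show ?thesis by blast
  qed
  obtain y where y: "\<And>i. i < d \<Longrightarrow> y i \<in> m"
    "\<And>i u. i < d \<Longrightarrow> y i * u \<in> lin_span y {..<i} \<Longrightarrow> u \<in> lin_span y {..<i}"
    using assms(4) by (auto simp: cohen_macaulay_def depth_eq_def regular_seq_in_def q)
  interpret cancellable_params a d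
  proof
    fix j u f assume j: "j < d" and u: "a j * u \<in> lin_span (\<lambda>i. a i ^ f i) ({..<d} - {j})"
    \<comment> \<open>Exponent \<open>1\<close> at \<open>j\<close> makes \<open>a j\<close> itself
      a member of the family. The regular sequence \<open>y\<close> lies in \<open>m\<close>, hence
      in the radical of the ideal of \<open>?x\<close>.\<close>
    let ?x = "\<lambda>i. a i ^ (f(j := 1)) i"
    have "lin_span ?x ({..<d} - {j}) = lin_span (\<lambda>i. a i ^ f i) ({..<d} - {j})"
      by (rule lin_span_cong) simp
    moreover have "?x j * u \<in> lin_span ?x ({..<d} - {j}) \<Longrightarrow> u \<in> lin_span ?x ({..<d} - {j})"
      by (rule regular_exchange[of d y, OF y(2) rad_pow[OF y(1)] j])
    ultimately show "u \<in> lin_span (\<lambda>i. a i ^ f i) ({..<d} - {j})" using u by simp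
  qed
  have frob: "frobenius_injective_cech p a d"
    using assms(5) am rad unfolding F_injective_def q by blast
  interpret frobenius_injective_params a d p
  proof
    fix u n assume "u ^ p \<in> Q (n * p)"
    then have "H_zero a d (u ^ p) (n * p)" by (simp add: H_zero_iff)
    \<comment> \<open>No subset of \<open>{..<d}\<close> has \<open>d + 1\<close> elements, so every
      cochain of top degree is a cocycle and F-injectivity applies in degree
      \<open>d\<close>.\<close>
    moreover have "\<not> (T \<subseteq> {..<d} \<and> card T = Suc d)" for T
      using card_mono[of "{..<d}" T] by auto
    then have "cech_cocycle a d d (\<lambda>S. u) n"
      unfolding cech_cocycle_def by blast
    ultimately have "H_zero a d u n"
      using frob unfolding frobenius_injective_cech_def H_zero_def by blast
    then show "u \<in> Q n" by (simp add: H_zero_iff)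
  qed (use \<open>prime p\<close> char in auto)
  show ?thesis
    unfolding q
  proof (rule maximal_members_eq)
    show "Z_set p (lin_span a {..<d}) \<subseteq> I_H p a d - {UNIV}"
      using q_of_in_I_H q_of_proper by (auto simp: Z_set_def)
    show "\<exists>J\<in>Z_set p (lin_span a {..<d}). I \<subseteq> J" if I: "I \<in> I_H p a d - {UNIV}" for I
    proof -
      obtain b where "b \<notin> q" "I \<subseteq> q_of p q b"
        using I_H_below_q_of[OF \<open>d > 0\<close>, of I] I by auto
      then show ?thesis by (auto simp: Z_set_def)
    qed
  qed
qed

end
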